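(* There exists an infinite family $\mathcal{F}$ of pairwise intersecting (closed) rectangles in $\mathbb{R}^2$, with bounded diameters (i.e. there is $R>0$ with $\mathrm{diam}(C)<R$ for all $C\in\mathcal{F}$) and non-zero areas, such that no finite set of points in $\mathbb{R}^2$ meets every rectangle of $\mathcal{F}$.
   Context: Rectangles are not required to be axis-parallel. *)

theory Defs
  imports "HOL-Analysis.Analysis"
begin

text \<open>
  Closed rectangles in the plane with a vertex \<open>a\<close> and orthogonal side vectors \<open>u\<close>, \<open>v\<close>, in arbitrary
  position (not necessarily axis-parallel). The side vectors may vanish, so degenerate rectangles
  are included here; non-degeneracy is the separate condition of having non-zero area.
\<close>

definition is_rectangle :: "(real ^ 2) set \<Rightarrow> bool" where
  "is_rectangle C \<longleftrightarrow>
     (\<exists>a u v. u \<bullet> v = 0 \<and>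
        C = {a + s *\<^sub>R u + t *\<^sub>R v | s t. 0 \<le> s \<and> s \<le> 1 \<and> 0 \<le> t \<and> t \<le> 1})"

end

theory Submission
  imports Defs "HOL-Real_Asymp.Real_Asymp"
begin

text \<open>
  Two tangents to the parabola \<open>y = x\<^sup>2\<close> at abscissae \<open>m, n \<in> [0, 1]\<close> meet at \<open>((m + n) / 2, m n)\<close>,
  so their pieces of slope vectors \<open>(1, 2 m)\<close> over \<open>[0, 1]\<close> cross pairwise. Thicken the piece at \<open>m\<close>
  to width of order \<open>m\<^sup>3\<close> and let \<open>m = 1 / (n + 1) \<rightarrow> 0\<close>. The width is negligible against the distance
  of any fixed point to the tangent: this distance tends to a positive limit off the \<open>x\<close>-axis, is of
  order \<open>m\<close> on the axis away from the origin, and of order \<open>m\<^sup>2\<close> at the origin. So every point lies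
  in finitely many of the rectangles, and no finite set can meet them all.
\<close>

definition rect :: "real ^ 2 \<Rightarrow> real ^ 2 \<Rightarrow> real ^ 2 \<Rightarrow> (real ^ 2) set" where
  "rect a u v = {a + s *\<^sub>R u + t *\<^sub>R v | s t. 0 \<le> s \<and> s \<le> 1 \<and> 0 \<le> t \<and> t \<le> 1}"

text \<open>As a translate of a linear image of the unit square, the set has the absolute value of a
  determinant as its area.\<close>

lemma rect_eq_image:
  "rect a u v = (+) a ` (\<lambda>z. z $ 1 *\<^sub>R u + z $ 2 *\<^sub>R v) ` cbox 0 (1 :: real ^ 2)"
proof (intro set_eqI iffI)
  fix p assume "p \<in> rect a u v"
  then obtain s t where st: "0 \<le> s" "s \<le> 1" "0 \<le> t" "t \<le> 1" "p = a + (s *\<^sub>R u + t *\<^sub>R v)"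
    by (auto simp: rect_def add.assoc)
  have "vector [s, t] \<in> cbox 0 (1 :: real ^ 2)"
    using st by (simp add: mem_box_cart forall_2)
  with st(5) show "p \<in> (+) a ` (\<lambda>z. z $ 1 *\<^sub>R u + z $ 2 *\<^sub>R v) ` cbox 0 (1 :: real ^ 2)"
    unfolding image_image by (intro image_eqI[where x = "vector [s, t]"]) simp_all
next
  fix p assume "p \<in> (+) a ` (\<lambda>z. z $ 1 *\<^sub>R u + z $ 2 *\<^sub>R v) ` cbox 0 (1 :: real ^ 2)"
  then show "p \<in> rect a u v"
    by (force simp: rect_def mem_box_cart add.assoc)
qed

lemma measure_rect: "measure lebesgue (rect a u v) = \<bar>u $ 1 * v $ 2 - u $ 2 * v $ 1\<bar>"
proof -
  let ?f = "\<lambda>z :: real ^ 2. z $ 1 *\<^sub>R u + z $ 2 *\<^sub>R v"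
  have lin: "linear ?f"
    by (rule linearI) (simp_all add: algebra_simps)
  have "measure lebesgue (cbox 0 (1 :: real ^ 2)) = 1"
    using content_cbox_cart[of 0 "1 :: real ^ 2"] by (simp add: interval_eq_empty_cart)
  moreover have "measure lebesgue (?f ` cbox 0 1) =
      \<bar>det (matrix ?f)\<bar> * measure lebesgue (cbox 0 (1 :: real ^ 2))"
    by (rule measure_linear_image[OF lin lmeasurable_cbox])
  moreover have "det (matrix ?f) = u $ 1 * v $ 2 - u $ 2 * v $ 1"
    by (simp add: det_2 matrix_def axis_def)
  ultimately show ?thesis
    by (simp add: rect_eq_image measure_translation)
qed

lemma diameter_rect_le: "diameter (rect a u v) \<le> 2 * (norm a + norm u + norm v)"
proof -
  have "norm p \<le> norm a + norm u + norm v" if p: "p \<in> rect a u v" for p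
  proof -
    obtain s t where st: "0 \<le> s" "s \<le> 1" "0 \<le> t" "t \<le> 1" "p = a + s *\<^sub>R u + t *\<^sub>R v"
      using p unfolding rect_def by blast
    have "norm p \<le> norm a + norm (s *\<^sub>R u) + norm (t *\<^sub>R v)"
      unfolding st(5) by (rule order_trans[OF norm_triangle_ineq add_right_mono[OF norm_triangle_ineq]])
    also have "\<dots> \<le> norm a + norm u + norm v"
      using st by (auto intro!: add_mono simp: mult_left_le_one_le)
    finally show ?thesis .
  qed
  then have "rect a u v \<subseteq> cball 0 (norm a + norm u + norm v)"
    by auto
  then have "diameter (rect a u v) \<le> diameter (cball (0 :: real ^ 2) (norm a + norm u + norm v))"
    by (rule diameter_subset) simp
  also have "\<dots> \<le> 2 * (norm a + norm u + norm v)"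
    by (simp add: add_nonneg_nonneg diameter_cball not_less)
  finally show ?thesis .
qed

text \<open>The vertex is the point of the tangent at abscissa 0. The second side is an upward
  normal, so the rectangle lies on the side of the tangent that contains the parabola.\<close>

definition tangent_rect :: "real \<Rightarrow> (real ^ 2) set" where
  "tangent_rect m = rect (vector [0, - m\<^sup>2]) (vector [1, 2 * m]) (m ^ 3 *\<^sub>R vector [- (2 * m), 1])"

lemma is_rectangle_tangent_rect: "is_rectangle (tangent_rect m)"
  unfolding is_rectangle_def tangent_rect_def rect_def
  by (rule exI, rule exI, rule exI, rule conjI[OF _ refl]) (simp add: inner_vec_def sum_2)

lemma tangent_rects_meet:
  assumes "m \<in> {0..1}" "n \<in> {0..1}"
  shows "tangent_rect m \<inter> tangent_rect n \<noteq> {}"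
proof -
  \<comment> \<open>The crossing point lies on the side \<open>t = 0\<close>, and \<open>s\<close>
    is its abscissa. It is symmetric in \<open>m\<close> and \<open>n\<close>, so one computation
    serves both rectangles.\<close>
  have "vector [(m + n) / 2, m * n] \<in> tangent_rect m"
    if "m \<in> {0..1}" "n \<in> {0..1}" for m n :: real
    unfolding tangent_rect_def rect_def mem_Collect_eq
    by (rule exI[of _ "(m + n) / 2"], rule exI[of _ 0])
       (use that in \<open>auto simp: vec_eq_iff forall_2 power2_eq_square field_simps\<close>)
  from this[OF assms] this[OF assms(2,1)] show ?thesis
    by (auto simp: add.commute mult.commute)
qed

lemma diameter_tangent_rect_le:
  assumes "m \<in> {0..1}"
  shows "diameter (tangent_rect m) \<le> 14"
proof -
  have l1: "norm (vector [x, y] :: real ^ 2) \<le> \<bar>x\<bar> + \<bar>y\<bar>" for x y :: real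
    using norm_le_l1_cart[of "vector [x, y] :: real ^ 2"] by (simp add: sum_2)
  have "m\<^sup>2 \<le> 1" "m ^ 3 \<le> 1"
    using assms by (auto intro: power_le_one)
  moreover have "norm (m ^ 3 *\<^sub>R (vector [- (2 * m), 1] :: real ^ 2)) \<le> 1 * 3"
    unfolding norm_scaleR
    by (rule mult_mono) (use assms l1[of "- (2 * m)" 1] in \<open>auto intro: power_le_one\<close>)
  \<comment> \<open>The vertex and the two sides have norms at most 1, 3 and 3, hence 2 * (1 + 3 +
    3) = 14.\<close>
  ultimately show ?thesis
    using diameter_rect_le[of "vector [0, - m\<^sup>2]" "vector [1, 2 * m]"
        "m ^ 3 *\<^sub>R vector [- (2 * m), 1]"]
      l1[of 0 "- m\<^sup>2"] l1[of 1 "2 * m"] assms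
    by (simp add: tangent_rect_def)
qed

lemma measure_tangent_rect_nonzero:
  assumes "m > 0"
  shows "measure lebesgue (tangent_rect m) \<noteq> 0"
proof -
  \<comment> \<open>This is the determinant of the two side vectors.\<close>
  have "m ^ 3 * (1 + 4 * m\<^sup>2) > 0"
    using assms by (simp add: add_pos_nonneg)
  then show ?thesis
    by (simp add: tangent_rect_def measure_rect power2_eq_square algebra_simps)
qed

text \<open>The expression is the vertical height of \<open>p\<close> above the tangent y = 2 m x -
  m^2. Moving along the first side leaves it unchanged; the second side adds at most m^3 (1 + 4
  m^2).\<close>

lemma tangent_rect_bounds:
  assumes "m \<in> {0..1}" "p \<in> tangent_rect m"
  shows "0 \<le> p $ 2 - 2 * m * p $ 1 + m\<^sup>2" "p $ 2 - 2 * m * p $ 1 + m\<^sup>2 \<le> 5 * m ^ 3"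
proof -
  obtain s t where t: "0 \<le> t" "t \<le> 1"
    and p: "p = vector [0, - m\<^sup>2] + s *\<^sub>R vector [1, 2 * m] + t *\<^sub>R m ^ 3 *\<^sub>R vector [- (2 * m), 1]"
    using assms(2) unfolding tangent_rect_def rect_def by blast
  have eq: "p $ 2 - 2 * m * p $ 1 + m\<^sup>2 = t * (1 + 4 * m\<^sup>2) * m ^ 3"
    by (simp add: p power2_eq_square algebra_simps)
  have "m\<^sup>2 \<le> 1"
    using assms(1) by (auto intro: power_le_one)
  then have "t * (1 + 4 * m\<^sup>2) \<le> 1 * 5"
    using t by (intro mult_mono) auto
  then show "p $ 2 - 2 * m * p $ 1 + m\<^sup>2 \<le> 5 * m ^ 3"
    unfolding eq using assms(1) by (intro mult_right_mono) auto
  show "0 \<le> p $ 2 - 2 * m * p $ 1 + m\<^sup>2"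
    unfolding eq using assms(1) t by simp
qed

lemma eventually_not_in_tangent_rect: "\<forall>\<^sub>F m in at_right 0. p \<notin> tangent_rect m"
proof -
  let ?g = "\<lambda>m. p $ 2 - 2 * m * p $ 1 + m\<^sup>2"
  \<comment> \<open>The cases fix the leading term of \<open>?g\<close> as \<open>m\<close> tends to
    0: \<open>p $ 2\<close>, else \<open>- 2 * m * p $ 1\<close>, else \<open>m\<^sup>2\<close>.
    Each dominates \<open>m ^ 3\<close>, so its sign tells which bound fails.\<close>
  consider "p $ 2 < 0" | "p $ 2 > 0" | "p $ 2 = 0" "p $ 1 > 0" | "p $ 2 = 0" "p $ 1 < 0"
    | "p $ 2 = 0" "p $ 1 = 0"
    by linarith
  then have "(\<forall>\<^sub>F m in at_right 0. ?g m < 0) \<or> (\<forall>\<^sub>F m in at_right 0. ?g m > 5 * m ^ 3)"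
  proof cases
    case 1
    then have "\<forall>\<^sub>F m in at_right 0. ?g m < 0" by real_asymp
    then show ?thesis ..
  next
    case 2
    then have "\<forall>\<^sub>F m in at_right 0. ?g m > 5 * m ^ 3" by real_asymp
    then show ?thesis ..
  next
    case 3
    from 3(2) have "\<forall>\<^sub>F m in at_right 0. 0 - 2 * m * p $ 1 + m\<^sup>2 < 0" by real_asymp
    with 3(1) show ?thesis by simp
  next
    case 4
    from 4(2) have "\<forall>\<^sub>F m in at_right 0. 0 - 2 * m * p $ 1 + m\<^sup>2 > 5 * m ^ 3" by real_asymp
    with 4(1) show ?thesis by simp
  next
    case 5
    have "\<forall>\<^sub>F m :: real in at_right 0. m\<^sup>2 > 5 * m ^ 3" by real_asymp
    with 5 show ?thesis by simp
  qed
  moreover have "\<forall>\<^sub>F m in at_right (0 :: real). m \<in> {0<..<1}"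
    by (rule eventually_at_right_real) simp
  ultimately show ?thesis
  proof (elim disjE)
    assume "\<forall>\<^sub>F m in at_right 0. ?g m < 0" "\<forall>\<^sub>F m in at_right (0 :: real). m \<in> {0<..<1}"
    then show ?thesis
    proof eventually_elim
      case (elim m)
      then show ?case
        using tangent_rect_bounds(1)[of m p] by auto
    qed
  next
    assume "\<forall>\<^sub>F m in at_right 0. ?g m > 5 * m ^ 3" "\<forall>\<^sub>F m in at_right (0 :: real). m \<in> {0<..<1}"
    then show ?thesis
    proof eventually_elim
      case (elim m)
      then show ?case
        using tangent_rect_bounds(2)[of m p] by auto
    qed
  qed
qed

theorem theorem13:
  "\<exists>F :: (real ^ 2) set set.
     infinite F \<and>
     (\<forall>C\<in>F. is_rectangle C) \<and>
     (\<forall>C\<in>F. \<forall>D\<in>F. C \<inter> D \<noteq> {}) \<and>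
     (\<exists>R>0. \<forall>C\<in>F. diameter C < R) \<and>
     (\<forall>C\<in>F. measure lebesgue C \<noteq> 0) \<and>
     \<not> (\<exists>P :: (real ^ 2) set. finite P \<and> (\<forall>C\<in>F. P \<inter> C \<noteq> {}))"
proof -
  \<comment> \<open>\<open>Suc\<close> keeps the values in (0, 1]: positive for non-zero area, at
    most 1 for the bounds.\<close>
  define m where "m n = 1 / real (Suc n)" for n
  define F where "F = range (tangent_rect \<circ> m)"
  have m: "m n \<in> {0..1}" "m n > 0" for n
    by (auto simp: m_def)
  have meet: "\<forall>C\<in>F. \<forall>D\<in>F. C \<inter> D \<noteq> {}"
    unfolding F_def using tangent_rects_meet[OF m(1) m(1)] by simp
  have m_lim: "filterlim m (at_right 0) sequentially"
    unfolding m_def by real_asymp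
  have unpierced: "\<not> (\<exists>P. finite P \<and> (\<forall>C\<in>F. P \<inter> C \<noteq> {}))"
  proof
    assume "\<exists>P. finite P \<and> (\<forall>C\<in>F. P \<inter> C \<noteq> {})"
    then obtain P where "finite P" and P: "\<And>n. P \<inter> tangent_rect (m n) \<noteq> {}"
      by (auto simp: F_def)
    \<comment> \<open>Finiteness of \<open>P\<close> turns a threshold for each point into a common
      one.\<close>
    then have "\<forall>\<^sub>F n in sequentially. \<forall>p\<in>P. p \<notin> tangent_rect (m n)"
      using eventually_compose_filterlim[OF eventually_not_in_tangent_rect m_lim]
      by (simp add: eventually_ball_finite)
    then obtain n where "\<forall>p\<in>P. p \<notin> tangent_rect (m n)"
      using eventually_happens trivial_limit_sequentially by blast
    with P[of n] show False by blast
  qed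
  \<comment> \<open>No injectivity is required: if \<open>F\<close> were finite, one point chosen
    from each member would pierce it. Members are nonempty because each meets itself.\<close>
  have "infinite F"
  proof
    assume "finite F"
    then have "finite ((\<lambda>C. SOME p. p \<in> C) ` F)" by simp
    moreover have "(SOME p. p \<in> C) \<in> C" if "C \<in> F" for C
      using meet that by (metis Int_absorb some_in_eq)
    ultimately show False
      using unpierced by blast
  qed
  moreover have "\<forall>C\<in>F. diameter C < 15"
    unfolding F_def using le_less_trans[OF diameter_tangent_rect_le[OF m(1)]] by simp
  moreover have "\<forall>C\<in>F. is_rectangle C" "\<forall>C\<in>F. measure lebesgue C \<noteq> 0"
    using is_rectangle_tangent_rect measure_tangent_rect_nonzero[OF m(2)] by (auto simp: F_def)
  moreover have "(0 :: real) < 15" by simp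
  ultimately show ?thesis
    using meet unpierced by blast
qed

end
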